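(* Let $s \colon S \rightarrowtail I$ be a subunit in a braided monoidal category $\mathbf{C}$. The restriction functor $\mathbf{C} \to \mathbf{C}|_s$, $A \mapsto S \otimes A$, $f \mapsto S \otimes f$, is a localisation of $\mathbf{C}$ at $\{ s \otimes A \mid A \in \mathbf{C} \}$.
   Context: An object name also denotes its identity morphism, so $s \otimes A \colon S \otimes A \to I \otimes A$ means $s \otimes \mathrm{id}_A$. A subunit in a braided monoidal category $\mathbf{C}$ with tensor unit $I$ is a subobject $s \colon S \rightarrowtail I$ such that $s \otimes S \colon S \otimes S \to I \otimes S$ is an isomorphism. $\mathbf{C}|_s$ is the full subcategory of $\mathbf{C}$ of objects $A$ for which $s \otimes A$ is an isomorphism. For a category $\mathbf{C}$ and a collection $\Sigma$ of morphisms, a localisation of $\mathbf{C}$ at $\Sigma$ is a category $\mathbf{C}[\Sigma^{-1}]$ and a functor $Q \colon \mathbf{C} \to \mathbf{C}[\Sigma^{-1}]$ such that: $Q(f)$ is an isomorphism for every $f \in \Sigma$; for any functor $R \colon \mathbf{C} \to \mathbf{D}$ such that $R(f)$ is an isomorphism for all $f \in \Sigma$, there exist a functor $\overline{R} \colon \mathbf{C}[\Sigma^{-1}] \to \mathbf{D}$ and a natural isomorphism $\overline{R} \circ Q \simeq R$; and precomposition $(-) \circ Q \colon [\mathbf{C}[\Sigma^{-1}],\mathbf{D}] \to [\mathbf{C},\mathbf{D}]$ is full and faithful for every category $\mathbf{D}$. *)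

theory Defs
  imports Main "HOL-Library.FuncSet"
begin

section \<open>Categories\<close>

text \<open>
  A category is given by a set of objects and a set of arrows inside two types; the operations
  are only meaningful on these sets. Composition is in applicative order: \<open>g \<cdot> f\<close> is ``\<open>g\<close>
  after \<open>f\<close>''.
\<close>

record ('o, 'm) category =
  Ob :: "'o set"
  Arr :: "'m set"
  Dom :: "'m \<Rightarrow> 'o"
  Cod :: "'m \<Rightarrow> 'o"
  Id :: "'o \<Rightarrow> 'm"
  Comp :: "'m \<Rightarrow> 'm \<Rightarrow> 'm" (infixr "\<cdot>\<index>" 70)

definition Hom :: "('o, 'm, 'z) category_scheme \<Rightarrow> 'o \<Rightarrow> 'o \<Rightarrow> 'm set" where
  "Hom C A B = {f \<in> Arr C. Dom C f = A \<and> Cod C f = B}"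

locale category =
  fixes C :: "('o, 'm, 'z) category_scheme" (structure)
  assumes Dom_in_Ob: "f \<in> Arr C \<Longrightarrow> Dom C f \<in> Ob C"
    and Cod_in_Ob: "f \<in> Arr C \<Longrightarrow> Cod C f \<in> Ob C"
    and Id_in_Hom: "A \<in> Ob C \<Longrightarrow> Id C A \<in> Hom C A A"
    and Comp_in_Hom: "f \<in> Hom C X Y \<Longrightarrow> g \<in> Hom C Y Z \<Longrightarrow> g \<cdot> f \<in> Hom C X Z"
    and Comp_Id: "f \<in> Hom C X Y \<Longrightarrow> f \<cdot> Id C X = f"
    and Id_Comp: "f \<in> Hom C X Y \<Longrightarrow> Id C Y \<cdot> f = f"
    and Comp_assoc: "f \<in> Hom C W X \<Longrightarrow> g \<in> Hom C X Y \<Longrightarrow> h \<in> Hom C Y Z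
      \<Longrightarrow> (h \<cdot> g) \<cdot> f = h \<cdot> (g \<cdot> f)"

definition inverse_arrows :: "('o, 'm, 'z) category_scheme \<Rightarrow> 'm \<Rightarrow> 'm \<Rightarrow> bool" where
  "inverse_arrows C f g \<longleftrightarrow>
     f \<in> Arr C \<and> g \<in> Hom C (Cod C f) (Dom C f) \<and>
     g \<cdot>\<^bsub>C\<^esub> f = Id C (Dom C f) \<and> f \<cdot>\<^bsub>C\<^esub> g = Id C (Cod C f)"

definition is_iso :: "('o, 'm, 'z) category_scheme \<Rightarrow> 'm \<Rightarrow> bool" where
  "is_iso C f \<longleftrightarrow> (\<exists>g. inverse_arrows C f g)"

text \<open>Only meaningful for isomorphisms, whose inverse is unique.\<close>

definition Inv :: "('o, 'm, 'z) category_scheme \<Rightarrow> 'm \<Rightarrow> 'm" where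
  "Inv C f = (THE g. inverse_arrows C f g)"

definition is_mono :: "('o, 'm, 'z) category_scheme \<Rightarrow> 'm \<Rightarrow> bool" where
  "is_mono C f \<longleftrightarrow> f \<in> Arr C \<and>
     (\<forall>X. \<forall>g \<in> Hom C X (Dom C f). \<forall>h \<in> Hom C X (Dom C f).
        f \<cdot>\<^bsub>C\<^esub> g = f \<cdot>\<^bsub>C\<^esub> h \<longrightarrow> g = h)"

definition full_subcategory ::
  "('o, 'm, 'z) category_scheme \<Rightarrow> ('o \<Rightarrow> bool) \<Rightarrow> ('o, 'm) category" where
  "full_subcategory C P =
     \<lparr>Ob = {A \<in> Ob C. P A},
      Arr = {f \<in> Arr C. P (Dom C f) \<and> P (Cod C f)},
      Dom = Dom C, Cod = Cod C, Id = Id C, Comp = Comp C\<rparr>"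


section \<open>Functors and natural transformations\<close>

text \<open>
  Functors and natural transformations take the value \<open>undefined\<close> off the objects and
  arrows of their source category, so that equality in HOL is the mathematical equality.
\<close>

record ('o, 'm, 'p, 'n) functor_data =
  ob_map :: "'o \<Rightarrow> 'p"
  arr_map :: "'m \<Rightarrow> 'n"

locale cat_functor = C: category C + D: category D
  for C :: "('o, 'm, 'z) category_scheme"
    and D :: "('p, 'n, 'y) category_scheme" +
  fixes F :: "('o, 'm, 'p, 'n) functor_data"
  assumes ob_map_in_Ob: "A \<in> Ob C \<Longrightarrow> ob_map F A \<in> Ob D"
    and arr_map_in_Hom: "f \<in> Hom C A B \<Longrightarrow> arr_map F f \<in> Hom D (ob_map F A) (ob_map F B)"
    and arr_map_Id: "A \<in> Ob C \<Longrightarrow> arr_map F (Id C A) = Id D (ob_map F A)"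
    and arr_map_Comp: "f \<in> Hom C X Y \<Longrightarrow> g \<in> Hom C Y Z
      \<Longrightarrow> arr_map F (g \<cdot>\<^bsub>C\<^esub> f) = arr_map F g \<cdot>\<^bsub>D\<^esub> arr_map F f"
    and ob_map_extensional: "ob_map F \<in> extensional (Ob C)"
    and arr_map_extensional: "arr_map F \<in> extensional (Arr C)"

locale full_functor = cat_functor +
  assumes full: "A \<in> Ob C \<Longrightarrow> B \<in> Ob C \<Longrightarrow> h \<in> Hom D (ob_map F A) (ob_map F B)
    \<Longrightarrow> \<exists>f \<in> Hom C A B. arr_map F f = h"

locale faithful_functor = cat_functor +
  assumes faithful: "A \<in> Ob C \<Longrightarrow> B \<in> Ob C \<Longrightarrow> f \<in> Hom C A B \<Longrightarrow> g \<in> Hom C A B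
    \<Longrightarrow> arr_map F f = arr_map F g \<Longrightarrow> f = g"

definition comp_functor ::
  "('o, 'm, 'z) category_scheme \<Rightarrow> ('p, 'n, 'q, 'k) functor_data
    \<Rightarrow> ('o, 'm, 'p, 'n) functor_data \<Rightarrow> ('o, 'm, 'q, 'k) functor_data" where
  "comp_functor C G F =
     \<lparr>ob_map = (\<lambda>A\<in>Ob C. ob_map G (ob_map F A)),
      arr_map = (\<lambda>f\<in>Arr C. arr_map G (arr_map F f))\<rparr>"

locale nat_trans = F: cat_functor C D F + G: cat_functor C D G
  for C :: "('o, 'm, 'z) category_scheme"
    and D :: "('p, 'n, 'y) category_scheme"
    and F G :: "('o, 'm, 'p, 'n) functor_data" +
  fixes \<tau> :: "'o \<Rightarrow> 'n"
  assumes component_in_Hom: "A \<in> Ob C \<Longrightarrow> \<tau> A \<in> Hom D (ob_map F A) (ob_map G A)"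
    and naturality: "f \<in> Hom C A B
      \<Longrightarrow> \<tau> B \<cdot>\<^bsub>D\<^esub> arr_map F f = arr_map G f \<cdot>\<^bsub>D\<^esub> \<tau> A"
    and component_extensional: "\<tau> \<in> extensional (Ob C)"

locale nat_iso = nat_trans +
  assumes component_iso: "A \<in> Ob C \<Longrightarrow> is_iso D (\<tau> A)"

text \<open>
  In the functor category an arrow carries its source and target functors, since these are not
  determined by the family of components.
\<close>

definition functor_category ::
  "('o, 'm, 'z) category_scheme \<Rightarrow> ('p, 'n, 'y) category_scheme
    \<Rightarrow> (('o, 'm, 'p, 'n) functor_data,
        ('o, 'm, 'p, 'n) functor_data \<times> ('o, 'm, 'p, 'n) functor_data \<times> ('o \<Rightarrow> 'n)) category" where
  "functor_category C D =
     \<lparr>Ob = {F. cat_functor C D F},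
      Arr = {(F, G, \<tau>). nat_trans C D F G \<tau>},
      Dom = (\<lambda>(F, G, \<tau>). F),
      Cod = (\<lambda>(F, G, \<tau>). G),
      Id = (\<lambda>F. (F, F, \<lambda>A\<in>Ob C. Id D (ob_map F A))),
      Comp = (\<lambda>(G', H, \<sigma>) (F, G, \<tau>). (F, H, \<lambda>A\<in>Ob C. \<sigma> A \<cdot>\<^bsub>D\<^esub> \<tau> A))\<rparr>"

definition precomposition ::
  "('o, 'm, 'z) category_scheme \<Rightarrow> ('l, 'k, 'y) category_scheme
    \<Rightarrow> ('p, 'n, 'x) category_scheme \<Rightarrow> ('o, 'm, 'l, 'k) functor_data
    \<Rightarrow> (('l, 'k, 'p, 'n) functor_data,
        ('l, 'k, 'p, 'n) functor_data \<times> ('l, 'k, 'p, 'n) functor_data \<times> ('l \<Rightarrow> 'n),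
        ('o, 'm, 'p, 'n) functor_data,
        ('o, 'm, 'p, 'n) functor_data \<times> ('o, 'm, 'p, 'n) functor_data \<times> ('o \<Rightarrow> 'n)) functor_data" where
  "precomposition C L D Q =
     \<lparr>ob_map = (\<lambda>F\<in>Ob (functor_category L D). comp_functor C F Q),
      arr_map = (\<lambda>(F, G, \<tau>)\<in>Arr (functor_category L D).
        (comp_functor C F Q, comp_functor C G Q, \<lambda>A\<in>Ob C. \<tau> (ob_map Q A)))\<rparr>"


section \<open>Localisation\<close>

text \<open>
  HOL cannot quantify over types inside a formula, so the types of objects and arrows of the test
  categories \<open>D\<close> are a parameter of the predicate. In a theorem they are type variables, independent
  of the types of \<open>C\<close> and \<open>L\<close>, so the theorem speaks of every category \<open>D\<close>.
\<close>

definition localisation ::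
  "('d, 'e) category itself \<Rightarrow> ('o, 'm, 'z) category_scheme \<Rightarrow> 'm set
    \<Rightarrow> ('l, 'k, 'y) category_scheme \<Rightarrow> ('o, 'm, 'l, 'k) functor_data \<Rightarrow> bool" where
  "localisation (_ :: ('d, 'e) category itself) C W L Q \<longleftrightarrow>
     category C \<and> W \<subseteq> Arr C \<and> category L \<and> cat_functor C L Q \<and>
     (\<forall>f\<in>W. is_iso L (arr_map Q f)) \<and>
     (\<forall>(D :: ('d, 'e) category) R.
        cat_functor C D R \<and> (\<forall>f\<in>W. is_iso D (arr_map R f)) \<longrightarrow>
        (\<exists>R' \<tau>. cat_functor L D R' \<and> nat_iso C D (comp_functor C R' Q) R \<tau>)) \<and>
     (\<forall>D :: ('d, 'e) category. category D \<longrightarrow>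
        full_functor (functor_category L D) (functor_category C D) (precomposition C L D Q) \<and>
        faithful_functor (functor_category L D) (functor_category C D) (precomposition C L D Q))"


section \<open>Braided monoidal categories\<close>

record ('o, 'm) monoidal_category = "('o, 'm) category" +
  tensor_ob :: "'o \<Rightarrow> 'o \<Rightarrow> 'o" (infixr "\<otimes>\<^sub>o\<index>" 75)
  tensor_arr :: "'m \<Rightarrow> 'm \<Rightarrow> 'm" (infixr "\<otimes>\<^sub>a\<index>" 75)
  unit_ob :: "'o"
  associator :: "'o \<Rightarrow> 'o \<Rightarrow> 'o \<Rightarrow> 'm"
  left_unitor :: "'o \<Rightarrow> 'm"
  right_unitor :: "'o \<Rightarrow> 'm"

locale monoidal_category = category C
  for C :: "('o, 'm, 'z) monoidal_category_scheme" (structure) +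
  assumes tensor_ob_in_Ob: "A \<in> Ob C \<Longrightarrow> B \<in> Ob C \<Longrightarrow> A \<otimes>\<^sub>o B \<in> Ob C"
    and tensor_arr_in_Hom: "f \<in> Hom C A B \<Longrightarrow> f' \<in> Hom C A' B'
      \<Longrightarrow> f \<otimes>\<^sub>a f' \<in> Hom C (A \<otimes>\<^sub>o A') (B \<otimes>\<^sub>o B')"
    and tensor_Id: "A \<in> Ob C \<Longrightarrow> B \<in> Ob C \<Longrightarrow> Id C A \<otimes>\<^sub>a Id C B = Id C (A \<otimes>\<^sub>o B)"
    and tensor_Comp: "f \<in> Hom C X Y \<Longrightarrow> g \<in> Hom C Y Z \<Longrightarrow> f' \<in> Hom C X' Y' \<Longrightarrow> g' \<in> Hom C Y' Z'
      \<Longrightarrow> (g \<cdot> f) \<otimes>\<^sub>a (g' \<cdot> f') = (g \<otimes>\<^sub>a g') \<cdot> (f \<otimes>\<^sub>a f')"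
    and unit_in_Ob: "unit_ob C \<in> Ob C"
    and associator_in_Hom: "X \<in> Ob C \<Longrightarrow> Y \<in> Ob C \<Longrightarrow> Z \<in> Ob C
      \<Longrightarrow> associator C X Y Z \<in> Hom C ((X \<otimes>\<^sub>o Y) \<otimes>\<^sub>o Z) (X \<otimes>\<^sub>o (Y \<otimes>\<^sub>o Z))"
    and associator_iso: "X \<in> Ob C \<Longrightarrow> Y \<in> Ob C \<Longrightarrow> Z \<in> Ob C \<Longrightarrow> is_iso C (associator C X Y Z)"
    and associator_natural:
      "f \<in> Hom C X X' \<Longrightarrow> g \<in> Hom C Y Y' \<Longrightarrow> h \<in> Hom C Z Z'
      \<Longrightarrow> associator C X' Y' Z' \<cdot> ((f \<otimes>\<^sub>a g) \<otimes>\<^sub>a h) = (f \<otimes>\<^sub>a (g \<otimes>\<^sub>a h)) \<cdot> associator C X Y Z"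
    and left_unitor_in_Hom: "A \<in> Ob C \<Longrightarrow> left_unitor C A \<in> Hom C (unit_ob C \<otimes>\<^sub>o A) A"
    and left_unitor_iso: "A \<in> Ob C \<Longrightarrow> is_iso C (left_unitor C A)"
    and left_unitor_natural: "f \<in> Hom C A B
      \<Longrightarrow> left_unitor C B \<cdot> (Id C (unit_ob C) \<otimes>\<^sub>a f) = f \<cdot> left_unitor C A"
    and right_unitor_in_Hom: "A \<in> Ob C \<Longrightarrow> right_unitor C A \<in> Hom C (A \<otimes>\<^sub>o unit_ob C) A"
    and right_unitor_iso: "A \<in> Ob C \<Longrightarrow> is_iso C (right_unitor C A)"
    and right_unitor_natural: "f \<in> Hom C A B
      \<Longrightarrow> right_unitor C B \<cdot> (f \<otimes>\<^sub>a Id C (unit_ob C)) = f \<cdot> right_unitor C A"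
    and pentagon: "W \<in> Ob C \<Longrightarrow> X \<in> Ob C \<Longrightarrow> Y \<in> Ob C \<Longrightarrow> Z \<in> Ob C
      \<Longrightarrow> associator C W X (Y \<otimes>\<^sub>o Z) \<cdot> associator C (W \<otimes>\<^sub>o X) Y Z
        = (Id C W \<otimes>\<^sub>a associator C X Y Z) \<cdot> associator C W (X \<otimes>\<^sub>o Y) Z
            \<cdot> (associator C W X Y \<otimes>\<^sub>a Id C Z)"
    and triangle: "X \<in> Ob C \<Longrightarrow> Y \<in> Ob C
      \<Longrightarrow> (Id C X \<otimes>\<^sub>a left_unitor C Y) \<cdot> associator C X (unit_ob C) Y
        = right_unitor C X \<otimes>\<^sub>a Id C Y"

record ('o, 'm) braided_monoidal_category = "('o, 'm) monoidal_category" +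
  braiding :: "'o \<Rightarrow> 'o \<Rightarrow> 'm"

locale braided_monoidal_category = monoidal_category C
  for C :: "('o, 'm, 'z) braided_monoidal_category_scheme" (structure) +
  assumes braiding_in_Hom: "X \<in> Ob C \<Longrightarrow> Y \<in> Ob C
      \<Longrightarrow> braiding C X Y \<in> Hom C (X \<otimes>\<^sub>o Y) (Y \<otimes>\<^sub>o X)"
    and braiding_iso: "X \<in> Ob C \<Longrightarrow> Y \<in> Ob C \<Longrightarrow> is_iso C (braiding C X Y)"
    and braiding_natural: "f \<in> Hom C X X' \<Longrightarrow> g \<in> Hom C Y Y'
      \<Longrightarrow> braiding C X' Y' \<cdot> (f \<otimes>\<^sub>a g) = (g \<otimes>\<^sub>a f) \<cdot> braiding C X Y"
    and hexagon1: "X \<in> Ob C \<Longrightarrow> Y \<in> Ob C \<Longrightarrow> Z \<in> Ob C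
      \<Longrightarrow> associator C Y Z X \<cdot> braiding C X (Y \<otimes>\<^sub>o Z) \<cdot> associator C X Y Z
        = (Id C Y \<otimes>\<^sub>a braiding C X Z) \<cdot> associator C Y X Z \<cdot> (braiding C X Y \<otimes>\<^sub>a Id C Z)"
    and hexagon2: "X \<in> Ob C \<Longrightarrow> Y \<in> Ob C \<Longrightarrow> Z \<in> Ob C
      \<Longrightarrow> Inv C (associator C Z X Y) \<cdot> braiding C (X \<otimes>\<^sub>o Y) Z \<cdot> Inv C (associator C X Y Z)
        = (braiding C X Z \<otimes>\<^sub>a Id C Y) \<cdot> Inv C (associator C X Z Y)
            \<cdot> (Id C X \<otimes>\<^sub>a braiding C Y Z)"


section \<open>Subunits and restriction\<close>

text \<open>The subobject is given by a representing monomorphism \<open>s : S \<rightarrow> I\<close>.\<close>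

definition subunit :: "('o, 'm, 'z) monoidal_category_scheme \<Rightarrow> 'o \<Rightarrow> 'm \<Rightarrow> bool" where
  "subunit C S s \<longleftrightarrow>
     s \<in> Hom C S (unit_ob C) \<and> is_mono C s \<and> is_iso C (s \<otimes>\<^sub>a\<^bsub>C\<^esub> Id C S)"

definition restriction_category ::
  "('o, 'm, 'z) monoidal_category_scheme \<Rightarrow> 'm \<Rightarrow> ('o, 'm) category" where
  "restriction_category C s = full_subcategory C (\<lambda>A. is_iso C (s \<otimes>\<^sub>a\<^bsub>C\<^esub> Id C A))"

definition restriction_functor ::
  "('o, 'm, 'z) monoidal_category_scheme \<Rightarrow> 'o \<Rightarrow> ('o, 'm, 'o, 'm) functor_data" where
  "restriction_functor C S =
     \<lparr>ob_map = (\<lambda>A\<in>Ob C. S \<otimes>\<^sub>o\<^bsub>C\<^esub> A),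
      arr_map = (\<lambda>f\<in>Arr C. Id C S \<otimes>\<^sub>a\<^bsub>C\<^esub> f)\<rparr>"

end

theory Submission
  imports Defs
begin

text \<open>
  Write \<open>Q A = S \<otimes> A\<close> and let \<open>e A = \<lambda> \<cdot> (s \<otimes> A) : Q A \<rightarrow> A\<close>, where \<open>\<lambda>\<close> is the left unitor. This is a
  natural transformation from \<open>Q\<close> to the identity functor, and \<open>C|\<^sub>s\<close> is the full subcategory of the
  objects \<open>A\<close> at which \<open>e A\<close> is an isomorphism. Since \<open>s \<otimes> S\<close> is an isomorphism, so is
  \<open>(s \<otimes> S) \<otimes> A\<close> and hence \<open>e (Q A)\<close>; the braiding turns \<open>s \<otimes> S\<close> into \<open>S \<otimes> s\<close>, so \<open>Q (e A)\<close> is an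
  isomorphism as well. From here on the tensor product can be forgotten: the theorem
  \<open>localisation_at_counit\<close> says that whenever \<open>e (Q A)\<close> and \<open>Q (e A)\<close> are isomorphisms for all \<open>A\<close>,
  the functor \<open>Q\<close>, with values in the full subcategory \<open>L\<close> of objects at which \<open>e\<close> is an
  isomorphism, is a localisation at the arrows \<open>e A\<close>.

  The key to it is the equation \<open>Q (e A) = e (Q A)\<close> (\<open>image_of_counit\<close>). If a functor \<open>R\<close> inverts
  all \<open>e A\<close>, then the arrows \<open>R (e A)\<close> form a natural isomorphism from \<open>R \<circ> Q\<close> to \<open>R\<close>, so the
  restriction of \<open>R\<close> to \<open>L\<close> is the required factorisation. A natural transformation
  \<open>\<tau> : F \<rightarrow> G\<close> of functors on \<open>L\<close> satisfies \<open>\<tau> A \<cdot> F (e A) = G (e A) \<cdot> \<tau> (Q A)\<close>, in which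
  \<open>F (e A)\<close> is invertible. So \<open>\<tau>\<close> is determined by its components at the objects \<open>Q A\<close>, which
  makes precomposition with \<open>Q\<close> faithful; and the same equation extends any \<open>\<sigma> : F \<circ> Q \<rightarrow> G \<circ> Q\<close>
  to a transformation \<open>\<tau>\<close> on \<open>L\<close>. The key equation, together with naturality of \<open>\<sigma>\<close> at \<open>e A\<close>,
  gives \<open>\<tau> (Q A) = \<sigma> A\<close>, so precomposition is full.

  Finally the arrows \<open>e A\<close> and \<open>s \<otimes> A\<close> differ by an isomorphism, so functors invert the former
  exactly when they invert the latter, and the two families have the same localisations.
\<close>


section \<open>Isomorphisms\<close>

context category
begin

lemma HomD:
  assumes "f \<in> Hom C A B"
  shows "f \<in> Arr C" "Dom C f = A" "Cod C f = B" "A \<in> Ob C" "B \<in> Ob C"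
  using assms Dom_in_Ob Cod_in_Ob by (auto simp: Hom_def)

lemma isoE:
  assumes "is_iso C f" "f \<in> Hom C A B"
  obtains g where "g \<in> Hom C B A" "g \<cdot> f = Id C A" "f \<cdot> g = Id C B"
  using assms by (auto simp: is_iso_def inverse_arrows_def Hom_def)

lemma isoI:
  assumes "f \<in> Hom C A B" "g \<in> Hom C B A" "g \<cdot> f = Id C A" "f \<cdot> g = Id C B"
  shows "is_iso C f"
  using assms by (auto simp: is_iso_def inverse_arrows_def Hom_def)

lemma is_iso_Id: "A \<in> Ob C \<Longrightarrow> is_iso C (Id C A)"
  by (rule isoI[OF Id_in_Hom Id_in_Hom]) (auto intro: Comp_Id Id_in_Hom)

lemma iso_extension:
  assumes "is_iso C f" "f \<in> Hom C A B" "g \<in> Hom C A X"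
  shows "\<exists>t\<in>Hom C B X. t \<cdot> f = g"
proof -
  obtain f' where f': "f' \<in> Hom C B A" "f' \<cdot> f = Id C A"
    using isoE[OF assms(1,2)] by blast
  have "(g \<cdot> f') \<cdot> f = g"
    using Comp_assoc[OF assms(2) f'(1) assms(3)] f'(2) Comp_Id[OF assms(3)] by simp
  then show ?thesis
    using Comp_in_Hom[OF f'(1) assms(3)] by blast
qed

lemma iso_cancel_right:
  assumes "is_iso C f" "f \<in> Hom C A B" "g \<in> Hom C B X" "h \<in> Hom C B X" "g \<cdot> f = h \<cdot> f"
  shows "g = h"
proof -
  obtain f' where f': "f' \<in> Hom C B A" "f \<cdot> f' = Id C B"
    using isoE[OF assms(1,2)] by blast
  show ?thesis
    using Comp_assoc[OF f'(1) assms(2) assms(3)] Comp_assoc[OF f'(1) assms(2) assms(4)]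
      f'(2) Comp_Id[OF assms(3)] Comp_Id[OF assms(4)] assms(5) by metis
qed

lemma iso_cancel_left:
  assumes "is_iso C f" "f \<in> Hom C A B" "g \<in> Hom C X A" "h \<in> Hom C X A" "f \<cdot> g = f \<cdot> h"
  shows "g = h"
proof -
  obtain f' where f': "f' \<in> Hom C B A" "f' \<cdot> f = Id C A"
    using isoE[OF assms(1,2)] by blast
  show ?thesis
    using Comp_assoc[OF assms(3) assms(2) f'(1)] Comp_assoc[OF assms(4) assms(2) f'(1)]
      f'(2) Id_Comp[OF assms(3)] Id_Comp[OF assms(4)] assms(5) by metis
qed

lemma is_iso_Comp:
  assumes "is_iso C f" "is_iso C g" "f \<in> Hom C A B" "g \<in> Hom C B X"
  shows "is_iso C (g \<cdot> f)"
proof -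
  obtain f' where f': "f' \<in> Hom C B A" "f' \<cdot> f = Id C A" "f \<cdot> f' = Id C B"
    using isoE[OF assms(1,3)] by blast
  obtain g' where g': "g' \<in> Hom C X B" "g' \<cdot> g = Id C B" "g \<cdot> g' = Id C X"
    using isoE[OF assms(2,4)] by blast
  note gf = Comp_in_Hom[OF assms(3,4)]
  note fg' = Comp_in_Hom[OF g'(1) f'(1)]
  have 1: "(f' \<cdot> g') \<cdot> (g \<cdot> f) = Id C A"
    using Comp_assoc[OF gf g'(1) f'(1)] Comp_assoc[OF assms(3,4) g'(1)] g'(2) f'(2)
      Id_Comp[OF assms(3)] by simp
  have 2: "(g \<cdot> f) \<cdot> (f' \<cdot> g') = Id C X"
    using Comp_assoc[OF fg' assms(3,4)] Comp_assoc[OF g'(1) f'(1) assms(3)] f'(3) g'(3)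
      Id_Comp[OF g'(1)] by simp
  show ?thesis
    by (rule isoI[OF gf fg' 1 2])
qed

lemma is_iso_Comp_cancel_left:
  assumes "is_iso C g" "is_iso C (g \<cdot> f)" "f \<in> Hom C A B" "g \<in> Hom C B X"
  shows "is_iso C f"
proof -
  obtain g' where g': "g' \<in> Hom C X B" "g' \<cdot> g = Id C B" "g \<cdot> g' = Id C X"
    using isoE[OF assms(1,4)] by blast
  have "is_iso C g'"
    using isoI[OF g'(1) assms(4)] g' by blast
  then have "is_iso C (g' \<cdot> (g \<cdot> f))"
    using is_iso_Comp[OF assms(2) _ Comp_in_Hom[OF assms(3,4)] g'(1)] by blast
  then show ?thesis
    using Comp_assoc[OF assms(3,4) g'(1)] g'(2) Id_Comp[OF assms(3)] by simp
qed

lemma is_iso_Comp_cancel_right: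
  assumes "is_iso C f" "is_iso C (g \<cdot> f)" "f \<in> Hom C A B" "g \<in> Hom C B X"
  shows "is_iso C g"
proof -
  obtain f' where f': "f' \<in> Hom C B A" "f' \<cdot> f = Id C A" "f \<cdot> f' = Id C B"
    using isoE[OF assms(1,3)] by blast
  have "is_iso C f'"
    using isoI[OF f'(1) assms(3)] f' by blast
  then have "is_iso C ((g \<cdot> f) \<cdot> f')"
    using is_iso_Comp[OF _ assms(2) f'(1) Comp_in_Hom[OF assms(3,4)]] by blast
  then show ?thesis
    using Comp_assoc[OF f'(1) assms(3,4)] f'(3) Comp_Id[OF assms(4)] by simp
qed

lemma is_iso_commutative_square:
  assumes "is_iso C a" "is_iso C b" "is_iso C f"
    and "a \<in> Hom C X X'" "b \<in> Hom C Y Y'" "f \<in> Hom C X Y" "g \<in> Hom C X' Y'"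
    and "b \<cdot> f = g \<cdot> a"
  shows "is_iso C g"
  using is_iso_Comp[OF assms(3,2,6,5)] is_iso_Comp_cancel_right[OF assms(1) _ assms(4,7)] assms(8)
  by simp

end

context cat_functor
begin

lemma arr_map_iso:
  assumes "is_iso C f" "f \<in> Arr C"
  shows "is_iso D (arr_map F f)"
proof -
  have f: "f \<in> Hom C (Dom C f) (Cod C f)"
    using assms(2) by (simp add: Hom_def)
  obtain g where g: "g \<in> Hom C (Cod C f) (Dom C f)"
    "g \<cdot>\<^bsub>C\<^esub> f = Id C (Dom C f)" "f \<cdot>\<^bsub>C\<^esub> g = Id C (Cod C f)"
    using C.isoE[OF assms(1) f] by blast
  show ?thesis
    using D.isoI[OF arr_map_in_Hom[OF f] arr_map_in_Hom[OF g(1)]]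
      arr_map_Comp[OF f g(1)] arr_map_Comp[OF g(1) f] arr_map_Id g C.HomD[OF f] by metis
qed

lemma arr_map_cancel_iso:
  assumes "is_iso C g" "f \<in> Hom C X Y" "g \<in> Hom C Y Z"
  shows "is_iso D (arr_map F (g \<cdot>\<^bsub>C\<^esub> f)) \<longleftrightarrow> is_iso D (arr_map F f)"
proof -
  have g: "is_iso D (arr_map F g)"
    using arr_map_iso[OF assms(1)] C.HomD[OF assms(3)] by blast
  show ?thesis
    unfolding arr_map_Comp[OF assms(2,3)]
    using D.is_iso_Comp[OF _ g] D.is_iso_Comp_cancel_left[OF g] assms(2,3) arr_map_in_Hom by blast
qed

end


section \<open>Full subcategories\<close>

lemma full_subcategory_simps [simp]:
  "Ob (full_subcategory C P) = {A \<in> Ob C. P A}"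
  "Arr (full_subcategory C P) = {f \<in> Arr C. P (Dom C f) \<and> P (Cod C f)}"
  "Dom (full_subcategory C P) = Dom C"
  "Cod (full_subcategory C P) = Cod C"
  "Id (full_subcategory C P) = Id C"
  "Comp (full_subcategory C P) = Comp C"
  by (simp_all add: full_subcategory_def)

lemma Hom_full_subcategory:
  "f \<in> Hom (full_subcategory C P) A B \<longleftrightarrow> f \<in> Hom C A B \<and> P A \<and> P B"
  by (auto simp: Hom_def)

text \<open>
  Domains and codomains are objects, so the predicate is only ever evaluated on objects.
\<close>

lemma full_subcategory_cong:
  assumes "category C" "\<And>A. A \<in> Ob C \<Longrightarrow> P A \<longleftrightarrow> P' A"
  shows "full_subcategory C P = full_subcategory C P'"
  unfolding full_subcategory_def
  using assms category.Dom_in_Ob[OF assms(1)] category.Cod_in_Ob[OF assms(1)] by auto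

context category
begin

lemma category_full_subcategory: "category (full_subcategory C P)"
  by unfold_locales
    (auto simp: Hom_full_subcategory Dom_in_Ob Cod_in_Ob Id_in_Hom Comp_in_Hom Comp_Id Id_Comp
      Comp_assoc)

lemma is_iso_full_subcategory:
  assumes "f \<in> Hom C A B" "P A" "P B"
  shows "is_iso (full_subcategory C P) f \<longleftrightarrow> is_iso C f"
  using assms HomD(1-3)[OF assms(1)]
  by (auto simp: is_iso_def inverse_arrows_def Hom_full_subcategory)

text \<open>
  The maps are identities cut down to the subcategory, because functors are required to be
  \<open>undefined\<close> off their source.
\<close>

definition inclusion_functor :: "('o \<Rightarrow> bool) \<Rightarrow> ('o, 'm, 'o, 'm) functor_data" where
  "inclusion_functor P =
     \<lparr>ob_map = (\<lambda>A\<in>Ob (full_subcategory C P). A), arr_map = (\<lambda>f\<in>Arr (full_subcategory C P). f)\<rparr>"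

lemma cat_functor_inclusion: "cat_functor (full_subcategory C P) C (inclusion_functor P)"
proof -
  interpret L: category "full_subcategory C P" by (rule category_full_subcategory)
  show ?thesis
  proof
    fix f A B assume f: "f \<in> Hom (full_subcategory C P) A B"
    show "arr_map (inclusion_functor P) f
        \<in> Hom C (ob_map (inclusion_functor P) A) (ob_map (inclusion_functor P) B)"
      using f L.HomD[OF f] by (simp add: inclusion_functor_def Hom_full_subcategory)
  next
    fix f g X Y Z
    assume f: "f \<in> Hom (full_subcategory C P) X Y" and g: "g \<in> Hom (full_subcategory C P) Y Z"
    show "arr_map (inclusion_functor P) (g \<cdot>\<^bsub>full_subcategory C P\<^esub> f)
        = arr_map (inclusion_functor P) g \<cdot> arr_map (inclusion_functor P) f"
      using L.HomD[OF f] L.HomD[OF g] L.HomD[OF L.Comp_in_Hom[OF f g]]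
      by (simp add: inclusion_functor_def)
  next
    fix A assume A: "A \<in> Ob (full_subcategory C P)"
    show "arr_map (inclusion_functor P) (Id (full_subcategory C P) A)
        = Id C (ob_map (inclusion_functor P) A)"
      using A L.HomD[OF L.Id_in_Hom[OF A]] by (simp add: inclusion_functor_def)
  qed (simp_all add: inclusion_functor_def)
qed

end


section \<open>Functor categories and precomposition\<close>

lemma cat_functor_comp:
  assumes "cat_functor C L F" "cat_functor L D G"
  shows "cat_functor C D (comp_functor C G F)"
proof -
  interpret F: cat_functor C L F by fact
  interpret G: cat_functor L D G by fact
  show ?thesis
  proof
    fix f A B assume f: "f \<in> Hom C A B"
    show "arr_map (comp_functor C G F) f
        \<in> Hom D (ob_map (comp_functor C G F) A) (ob_map (comp_functor C G F) B)"
      using G.arr_map_in_Hom[OF F.arr_map_in_Hom[OF f]] F.C.HomD[OF f]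
      by (simp add: comp_functor_def)
  next
    fix f g X Y Z assume f: "f \<in> Hom C X Y" and g: "g \<in> Hom C Y Z"
    show "arr_map (comp_functor C G F) (g \<cdot>\<^bsub>C\<^esub> f)
        = arr_map (comp_functor C G F) g \<cdot>\<^bsub>D\<^esub> arr_map (comp_functor C G F) f"
      using F.arr_map_Comp[OF f g] G.arr_map_Comp[OF F.arr_map_in_Hom[OF f] F.arr_map_in_Hom[OF g]]
        F.C.HomD(1)[OF f] F.C.HomD(1)[OF g] F.C.HomD(1)[OF F.C.Comp_in_Hom[OF f g]]
      by (simp add: comp_functor_def)
  next
    fix A assume A: "A \<in> Ob C"
    show "arr_map (comp_functor C G F) (Id C A) = Id D (ob_map (comp_functor C G F) A)"
      using A F.C.HomD(1)[OF F.C.Id_in_Hom[OF A]]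
      by (simp add: comp_functor_def F.arr_map_Id G.arr_map_Id F.ob_map_in_Ob)
  qed (simp_all add: comp_functor_def F.ob_map_in_Ob G.ob_map_in_Ob)
qed

lemma comp_functor_apply:
  "A \<in> Ob C \<Longrightarrow> ob_map (comp_functor C G F) A = ob_map G (ob_map F A)"
  "f \<in> Arr C \<Longrightarrow> arr_map (comp_functor C G F) f = arr_map G (arr_map F f)"
  by (simp_all add: comp_functor_def)

lemma nat_trans_Id:
  assumes "cat_functor C D F"
  shows "nat_trans C D F F (\<lambda>A\<in>Ob C. Id D (ob_map F A))"
proof -
  interpret F: cat_functor C D F by fact
  show ?thesis
  proof unfold_locales
    fix f A B assume f: "f \<in> Hom C A B"
    show "(\<lambda>A\<in>Ob C. Id D (ob_map F A)) B \<cdot>\<^bsub>D\<^esub> arr_map F f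
        = arr_map F f \<cdot>\<^bsub>D\<^esub> (\<lambda>A\<in>Ob C. Id D (ob_map F A)) A"
      using F.C.HomD(4,5)[OF f]
      by (simp add: F.D.Id_Comp[OF F.arr_map_in_Hom[OF f]] F.D.Comp_Id[OF F.arr_map_in_Hom[OF f]])
  qed (simp_all add: F.D.Id_in_Hom F.ob_map_in_Ob)
qed

lemma nat_trans_Comp:
  assumes "nat_trans C D F G \<tau>" "nat_trans C D G H \<sigma>"
  shows "nat_trans C D F H (\<lambda>A\<in>Ob C. \<sigma> A \<cdot>\<^bsub>D\<^esub> \<tau> A)"
proof -
  interpret \<tau>: nat_trans C D F G \<tau> by fact
  interpret \<sigma>: nat_trans C D G H \<sigma> by fact
  show ?thesis
  proof unfold_locales
    fix f A B assume f: "f \<in> Hom C A B"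
    note AB = \<tau>.F.C.HomD(4,5)[OF f]
    note hom = \<tau>.component_in_Hom \<sigma>.component_in_Hom
    have "(\<sigma> B \<cdot>\<^bsub>D\<^esub> \<tau> B) \<cdot>\<^bsub>D\<^esub> arr_map F f = \<sigma> B \<cdot>\<^bsub>D\<^esub> (arr_map G f \<cdot>\<^bsub>D\<^esub> \<tau> A)"
      using \<tau>.F.D.Comp_assoc[OF \<tau>.F.arr_map_in_Hom[OF f] hom[OF AB(2)]] \<tau>.naturality[OF f] by simp
    also have "\<dots> = (arr_map H f \<cdot>\<^bsub>D\<^esub> \<sigma> A) \<cdot>\<^bsub>D\<^esub> \<tau> A"
      using \<tau>.F.D.Comp_assoc[OF hom(1)[OF AB(1)] \<tau>.G.arr_map_in_Hom[OF f] hom(2)[OF AB(2)]]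
        \<sigma>.naturality[OF f] by simp
    also have "\<dots> = arr_map H f \<cdot>\<^bsub>D\<^esub> (\<sigma> A \<cdot>\<^bsub>D\<^esub> \<tau> A)"
      using \<tau>.F.D.Comp_assoc[OF hom(1)[OF AB(1)] hom(2)[OF AB(1)] \<sigma>.G.arr_map_in_Hom[OF f]] .
    finally show "(\<lambda>A\<in>Ob C. \<sigma> A \<cdot>\<^bsub>D\<^esub> \<tau> A) B \<cdot>\<^bsub>D\<^esub> arr_map F f
        = arr_map H f \<cdot>\<^bsub>D\<^esub> (\<lambda>A\<in>Ob C. \<sigma> A \<cdot>\<^bsub>D\<^esub> \<tau> A) A"
      using AB by simp
  qed (auto intro: \<tau>.F.D.Comp_in_Hom \<tau>.component_in_Hom \<sigma>.component_in_Hom)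
qed

lemma nat_trans_whisker:
  assumes "cat_functor C L Q" "nat_trans L D F G \<tau>"
  shows "nat_trans C D (comp_functor C F Q) (comp_functor C G Q) (\<lambda>A\<in>Ob C. \<tau> (ob_map Q A))"
proof -
  interpret Q: cat_functor C L Q by fact
  interpret \<tau>: nat_trans L D F G \<tau> by fact
  interpret FQ: cat_functor C D "comp_functor C F Q"
    using cat_functor_comp[OF assms(1) \<tau>.F.cat_functor_axioms] .
  interpret GQ: cat_functor C D "comp_functor C G Q"
    using cat_functor_comp[OF assms(1) \<tau>.G.cat_functor_axioms] .
  show ?thesis
  proof unfold_locales
    fix f A B assume f: "f \<in> Hom C A B"
    show "(\<lambda>A\<in>Ob C. \<tau> (ob_map Q A)) B \<cdot>\<^bsub>D\<^esub> arr_map (comp_functor C F Q) f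
        = arr_map (comp_functor C G Q) f \<cdot>\<^bsub>D\<^esub> (\<lambda>A\<in>Ob C. \<tau> (ob_map Q A)) A"
      using \<tau>.naturality[OF Q.arr_map_in_Hom[OF f]] Q.C.HomD[OF f] by (simp add: comp_functor_apply)
  qed (simp_all add: comp_functor_apply \<tau>.component_in_Hom Q.ob_map_in_Ob)
qed

lemma Hom_functor_category:
  "t \<in> Hom (functor_category C D) F G \<longleftrightarrow> (\<exists>\<tau>. t = (F, G, \<tau>) \<and> nat_trans C D F G \<tau>)"
  by (auto simp: Hom_def functor_category_def)

lemma functor_category_simps [simp]:
  "Ob (functor_category C D) = {F. cat_functor C D F}"
  "Arr (functor_category C D) = {(F, G, \<tau>). nat_trans C D F G \<tau>}"
  "Dom (functor_category C D) (F, G, \<tau>) = F"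
  "Cod (functor_category C D) (F, G, \<tau>) = G"
  "Id (functor_category C D) F = (F, F, \<lambda>A\<in>Ob C. Id D (ob_map F A))"
  "(G', H, \<sigma>) \<cdot>\<^bsub>functor_category C D\<^esub> (F, G, \<tau>) = (F, H, \<lambda>A\<in>Ob C. \<sigma> A \<cdot>\<^bsub>D\<^esub> \<tau> A)"
  by (simp_all add: functor_category_def)

text \<open>
  Families of components are \<open>undefined\<close> off the objects, so they are equal as soon as they agree
  on objects.
\<close>

lemma nat_trans_eqI:
  assumes "nat_trans C D F G \<tau>" "nat_trans C D F' G' \<sigma>" "\<And>A. A \<in> Ob C \<Longrightarrow> \<tau> A = \<sigma> A"
  shows "\<tau> = \<sigma>"
  using assms nat_trans.component_extensional extensionalityI by metis

lemma category_functor_category: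
  assumes "category C" "category D"
  shows "category (functor_category C D)"
proof -
  interpret D: category D by fact
  note nat = nat_trans.component_in_Hom
  show ?thesis
  proof
    fix t X Y assume "t \<in> Hom (functor_category C D) X Y"
    then obtain \<tau> where t: "t = (X, Y, \<tau>)" and \<tau>: "nat_trans C D X Y \<tau>"
      by (auto simp: Hom_functor_category)
    interpret \<tau>: nat_trans C D X Y \<tau> by fact
    show "t \<cdot>\<^bsub>functor_category C D\<^esub> Id (functor_category C D) X = t"
      using nat_trans_eqI[OF nat_trans_Comp[OF nat_trans_Id[OF \<tau>.F.cat_functor_axioms] \<tau>] \<tau>]
      by (simp add: t D.Comp_Id[OF \<tau>.component_in_Hom])
    show "Id (functor_category C D) Y \<cdot>\<^bsub>functor_category C D\<^esub> t = t"
      using nat_trans_eqI[OF nat_trans_Comp[OF \<tau> nat_trans_Id[OF \<tau>.G.cat_functor_axioms]] \<tau>]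
      by (simp add: t D.Id_Comp[OF \<tau>.component_in_Hom])
  next
    fix r t u W X Y Z
    assume "r \<in> Hom (functor_category C D) W X" "t \<in> Hom (functor_category C D) X Y"
      "u \<in> Hom (functor_category C D) Y Z"
    then obtain \<rho> \<tau> \<upsilon> where r: "r = (W, X, \<rho>)" "nat_trans C D W X \<rho>"
      and t: "t = (X, Y, \<tau>)" "nat_trans C D X Y \<tau>" and u: "u = (Y, Z, \<upsilon>)" "nat_trans C D Y Z \<upsilon>"
      by (auto simp: Hom_functor_category)
    show "(u \<cdot>\<^bsub>functor_category C D\<^esub> t) \<cdot>\<^bsub>functor_category C D\<^esub> r
        = u \<cdot>\<^bsub>functor_category C D\<^esub> (t \<cdot>\<^bsub>functor_category C D\<^esub> r)"
      using D.Comp_assoc[OF nat[OF r(2)] nat[OF t(2)] nat[OF u(2)]]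
      by (simp add: r t u cong: restrict_cong)
  qed (auto simp: Hom_functor_category nat_trans_Id nat_trans_Comp dest: nat_trans.axioms)
qed

lemma precomposition_apply:
  "cat_functor L D F \<Longrightarrow> ob_map (precomposition C L D Q) F = comp_functor C F Q"
  "nat_trans L D F G \<tau> \<Longrightarrow> arr_map (precomposition C L D Q) (F, G, \<tau>)
     = (comp_functor C F Q, comp_functor C G Q, \<lambda>A\<in>Ob C. \<tau> (ob_map Q A))"
  by (simp_all add: precomposition_def)

lemma cat_functor_precomposition:
  assumes Q: "cat_functor C L Q" and D: "category D"
  shows "cat_functor (functor_category L D) (functor_category C D) (precomposition C L D Q)"
proof -
  interpret Q: cat_functor C L Q by fact
  interpret D: category D by fact
  interpret FL: category "functor_category L D"
    by (rule category_functor_category) unfold_locales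
  interpret FC: category "functor_category C D"
    by (rule category_functor_category) unfold_locales
  show ?thesis
  proof
    fix F assume "F \<in> Ob (functor_category L D)"
    then have F: "cat_functor L D F" by simp
    show "ob_map (precomposition C L D Q) F \<in> Ob (functor_category C D)"
      using F cat_functor_comp[OF Q F] by (simp add: precomposition_apply)
    show "arr_map (precomposition C L D Q) (Id (functor_category L D) F)
        = Id (functor_category C D) (ob_map (precomposition C L D Q) F)"
      using F by (auto simp: precomposition_apply nat_trans_Id comp_functor_apply Q.ob_map_in_Ob
          intro!: restrict_ext)
  next
    fix t F G assume "t \<in> Hom (functor_category L D) F G"
    then obtain \<tau> where t: "t = (F, G, \<tau>)" and \<tau>: "nat_trans L D F G \<tau>"
      by (auto simp: Hom_functor_category)
    then have "cat_functor L D F" "cat_functor L D G"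
      by (auto dest: nat_trans.axioms)
    then show "arr_map (precomposition C L D Q) t \<in> Hom (functor_category C D)
        (ob_map (precomposition C L D Q) F) (ob_map (precomposition C L D Q) G)"
      using nat_trans_whisker[OF Q \<tau>] \<tau> by (simp add: t precomposition_apply Hom_functor_category)
  next
    fix t u X Y Z
    assume "t \<in> Hom (functor_category L D) X Y" "u \<in> Hom (functor_category L D) Y Z"
    then show "arr_map (precomposition C L D Q) (u \<cdot>\<^bsub>functor_category L D\<^esub> t)
        = arr_map (precomposition C L D Q) u \<cdot>\<^bsub>functor_category C D\<^esub> arr_map (precomposition C L D Q) t"
      by (auto simp: Hom_functor_category precomposition_apply nat_trans_Comp Q.ob_map_in_Ob
          intro!: restrict_ext)
  qed (auto simp: precomposition_def)
qed


section \<open>Idempotent copointed endofunctors\<close>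

text \<open>
  Up to equivalence these are the coreflections onto a full subcategory: by the lemma
  \<open>image_of_counit\<close> below, \<open>Q\<close> underlies an idempotent comonad whose comultiplication is the
  inverse of \<open>e Q = Q e\<close>. Asking only that both transformations be invertible leaves less to
  check in an example than asking for their equality.
\<close>

locale idempotent_copointed_endofunctor = Q: cat_functor C C Q
  for C :: "('o, 'm, 'z) category_scheme" (structure)
    and Q :: "('o, 'm, 'o, 'm) functor_data" +
  fixes e :: "'o \<Rightarrow> 'm"
  assumes counit_in_Hom: "A \<in> Ob C \<Longrightarrow> e A \<in> Hom C (ob_map Q A) A"
    and counit_natural: "f \<in> Hom C A B \<Longrightarrow> e B \<cdot> arr_map Q f = f \<cdot> e A"
    and counit_of_image_iso: "A \<in> Ob C \<Longrightarrow> is_iso C (e (ob_map Q A))"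
    and image_of_counit_iso: "A \<in> Ob C \<Longrightarrow> is_iso C (arr_map Q (e A))"
begin

abbreviation L :: "('o, 'm) category" where
  "L \<equiv> full_subcategory C (\<lambda>A. is_iso C (e A))"

text \<open>
  By naturality \<open>f \<cdot> e A = e B \<cdot> Q f\<close>, so \<open>Q f\<close> determines \<open>f\<close> when \<open>e A\<close> can be cancelled.
\<close>

lemma faithful_on_fixed_objects:
  assumes "is_iso C (e A)" and f: "f \<in> Hom C A B" and g: "g \<in> Hom C A B"
    and "arr_map Q f = arr_map Q g"
  shows "f = g"
proof -
  have "f \<cdot> e A = g \<cdot> e A"
    using counit_natural[OF f] counit_natural[OF g] assms(4) by simp
  then show ?thesis
    using Q.C.iso_cancel_right[OF assms(1) counit_in_Hom f g] Q.C.HomD[OF f] by blast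
qed

text \<open>
  Naturality of \<open>e\<close> at \<open>e A\<close> reads \<open>e A \<cdot> Q (e A) = e A \<cdot> e (Q A)\<close>, but \<open>e A\<close> need not be monic.
  After applying \<open>Q\<close> it becomes the isomorphism \<open>Q (e A)\<close> and can be cancelled, so \<open>Q (e A)\<close> and
  \<open>e (Q A)\<close> have the same image under \<open>Q\<close>; and \<open>Q\<close> is faithful on arrows out of \<open>Q (Q A)\<close>.
\<close>

lemma image_of_counit:
  assumes A: "A \<in> Ob C"
  shows "arr_map Q (e A) = e (ob_map Q A)"
proof (rule faithful_on_fixed_objects)
  note QA = Q.ob_map_in_Ob[OF A]
  note e = counit_in_Hom[OF A]
  note Qe = Q.arr_map_in_Hom[OF e]
  note eQ = counit_in_Hom[OF QA]
  show "is_iso C (e (ob_map Q (ob_map Q A)))"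
    using counit_of_image_iso[OF QA] .
  show "arr_map Q (e A) \<in> Hom C (ob_map Q (ob_map Q A)) (ob_map Q A)"
    using Qe .
  show "e (ob_map Q A) \<in> Hom C (ob_map Q (ob_map Q A)) (ob_map Q A)"
    using eQ .
  have "arr_map Q (e A) \<cdot> arr_map Q (arr_map Q (e A)) = arr_map Q (e A) \<cdot> arr_map Q (e (ob_map Q A))"
    using counit_natural[OF e] Q.arr_map_Comp[OF Qe e] Q.arr_map_Comp[OF eQ e] by simp
  then show "arr_map Q (arr_map Q (e A)) = arr_map Q (e (ob_map Q A))"
    by (rule Q.C.iso_cancel_left[OF image_of_counit_iso[OF A] Qe Q.arr_map_in_Hom[OF Qe]
          Q.arr_map_in_Hom[OF eQ]])
qed

lemma counit_in_Hom_L: "A \<in> Ob L \<Longrightarrow> e A \<in> Hom L (ob_map Q A) A"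
  by (auto simp: Hom_full_subcategory counit_in_Hom counit_of_image_iso)

lemma counit_iso_L: "A \<in> Ob L \<Longrightarrow> is_iso L (e A)"
  using Q.C.is_iso_full_subcategory[OF counit_in_Hom] counit_of_image_iso by simp

text \<open>
  Since \<open>L\<close> is full and contains every \<open>Q A\<close>, the endofunctor \<open>Q\<close> is at once a functor to \<open>L\<close>,
  with the same underlying maps.
\<close>

lemma cat_functor_corestriction: "cat_functor C L Q"
proof -
  interpret L: category L by (rule Q.C.category_full_subcategory)
  show ?thesis
  proof unfold_locales
    fix f A B assume f: "f \<in> Hom C A B"
    show "arr_map Q f \<in> Hom L (ob_map Q A) (ob_map Q B)"
      using Q.arr_map_in_Hom[OF f] Q.C.HomD(4,5)[OF f]
      by (simp add: Hom_full_subcategory counit_of_image_iso)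
  qed (simp_all add: Q.ob_map_in_Ob Q.arr_map_Id Q.arr_map_Comp counit_of_image_iso
      Q.ob_map_extensional Q.arr_map_extensional)
qed

text \<open>
  The functor induced by \<open>R\<close> is its restriction to \<open>L\<close>, and the comparison at \<open>A\<close> is \<open>R (e A)\<close>.
\<close>

lemma extension_of_inverting_functor:
  assumes "cat_functor C D R" and inv: "\<And>A. A \<in> Ob C \<Longrightarrow> is_iso D (arr_map R (e A))"
  shows "\<exists>R' \<tau>. cat_functor L D R' \<and> nat_iso C D (comp_functor C R' Q) R \<tau>"
proof (intro exI conjI)
  interpret R: cat_functor C D R by fact
  let ?R = "comp_functor L R (Q.C.inclusion_functor (\<lambda>A. is_iso C (e A)))"
  let ?\<tau> = "\<lambda>A\<in>Ob C. arr_map R (e A)"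
  show R': "cat_functor L D ?R"
    using cat_functor_comp[OF Q.C.cat_functor_inclusion assms(1)] .
  interpret Q': cat_functor C L Q by (rule cat_functor_corestriction)
  interpret R'Q: cat_functor C D "comp_functor C ?R Q"
    using cat_functor_comp[OF cat_functor_corestriction R'] .
  have R'Q_ob: "ob_map (comp_functor C ?R Q) A = ob_map R (ob_map Q A)" if "A \<in> Ob C" for A
    using Q'.ob_map_in_Ob[OF that] that
    by (simp add: comp_functor_def Q.C.inclusion_functor_def)
  have R'Q_arr: "arr_map (comp_functor C ?R Q) f = arr_map R (arr_map Q f)" if "f \<in> Hom C A B" for f A B
    using Q'.D.HomD(1)[OF Q'.arr_map_in_Hom[OF that]] Q.C.HomD(1)[OF that]
    by (simp add: comp_functor_def Q.C.inclusion_functor_def)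
  show "nat_iso C D (comp_functor C ?R Q) R ?\<tau>"
  proof unfold_locales
    fix f A B assume f: "f \<in> Hom C A B"
    note AB = Q.C.HomD(4,5)[OF f]
    show "?\<tau> B \<cdot>\<^bsub>D\<^esub> arr_map (comp_functor C ?R Q) f = arr_map R f \<cdot>\<^bsub>D\<^esub> ?\<tau> A"
      using AB R.arr_map_Comp[OF counit_in_Hom[OF AB(1)] f]
        R.arr_map_Comp[OF Q.arr_map_in_Hom[OF f] counit_in_Hom[OF AB(2)]] counit_natural[OF f]
      by (simp add: R'Q_arr[OF f])
  qed (auto simp: R'Q_ob inv intro: R.arr_map_in_Hom counit_in_Hom)
qed

text \<open>
  By naturality at the isomorphism \<open>e A\<close>, the component of a transformation at an object \<open>A\<close> of
  \<open>L\<close> is determined by the one at \<open>Q A\<close>.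
\<close>

lemma precomposition_faithful:
  assumes "category D"
  shows "faithful_functor (functor_category L D) (functor_category C D) (precomposition C L D Q)"
proof -
  interpret Q': cat_functor C L Q by (rule cat_functor_corestriction)
  interpret D: category D by fact
  interpret P: cat_functor "functor_category L D" "functor_category C D" "precomposition C L D Q"
    using cat_functor_precomposition[OF cat_functor_corestriction assms] .
  show ?thesis
  proof unfold_locales
    fix F G t u
    assume "t \<in> Hom (functor_category L D) F G" "u \<in> Hom (functor_category L D) F G"
      and eq: "arr_map (precomposition C L D Q) t = arr_map (precomposition C L D Q) u"
    then obtain \<tau> \<sigma> where t: "t = (F, G, \<tau>)" "nat_trans L D F G \<tau>"
      and u: "u = (F, G, \<sigma>)" "nat_trans L D F G \<sigma>"
      by (auto simp: Hom_functor_category)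
    interpret \<tau>: nat_trans L D F G \<tau> by fact
    interpret \<sigma>: nat_trans L D F G \<sigma> by fact
    have agree: "\<tau> (ob_map Q A) = \<sigma> (ob_map Q A)" if "A \<in> Ob C" for A
      using eq that t u by (simp add: precomposition_apply) (metis restrict_apply')
    have "\<tau> A = \<sigma> A" if A: "A \<in> Ob L" for A
    proof (rule D.iso_cancel_right)
      note e = counit_in_Hom_L[OF A]
      show "is_iso D (arr_map F (e A))"
        using \<tau>.F.arr_map_iso[OF counit_iso_L[OF A]] Q'.D.HomD(1)[OF e] by blast
      show "arr_map F (e A) \<in> Hom D (ob_map F (ob_map Q A)) (ob_map F A)"
        using \<tau>.F.arr_map_in_Hom[OF e] .
      show "\<tau> A \<in> Hom D (ob_map F A) (ob_map G A)" "\<sigma> A \<in> Hom D (ob_map F A) (ob_map G A)"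
        using A by (simp_all add: \<tau>.component_in_Hom \<sigma>.component_in_Hom)
      show "\<tau> A \<cdot>\<^bsub>D\<^esub> arr_map F (e A) = \<sigma> A \<cdot>\<^bsub>D\<^esub> arr_map F (e A)"
        using \<tau>.naturality[OF e] \<sigma>.naturality[OF e] agree A by simp
    qed
    then show "t = u"
      using nat_trans_eqI[OF t(2) u(2)] t(1) u(1) by blast
  qed
qed

text \<open>
  The component of \<open>\<tau>\<close> at an object \<open>A\<close> of \<open>L\<close> is forced to be the unique \<open>t A\<close> with
  \<open>t A \<cdot> F (e A) = G (e A) \<cdot> \<sigma> A\<close>. Naturality of \<open>t\<close> and the equation \<open>t (Q A) = \<sigma> A\<close> are both
  checked after composing with the invertible \<open>F (e _)\<close>.
\<close>

lemma whiskering_surjective: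
  assumes F: "cat_functor L D F" and G: "cat_functor L D G"
    and \<sigma>: "nat_trans C D (comp_functor C F Q) (comp_functor C G Q) \<sigma>"
  obtains \<tau> where "nat_trans L D F G \<tau>" "\<And>A. A \<in> Ob C \<Longrightarrow> \<tau> (ob_map Q A) = \<sigma> A"
proof -
  interpret F: cat_functor L D F by fact
  interpret G: cat_functor L D G by fact
  interpret Q': cat_functor C L Q by (rule cat_functor_corestriction)
  interpret \<sigma>: nat_trans C D "comp_functor C F Q" "comp_functor C G Q" \<sigma> by fact
  have \<sigma>_Hom: "\<sigma> A \<in> Hom D (ob_map F (ob_map Q A)) (ob_map G (ob_map Q A))" if "A \<in> Ob C" for A
    using \<sigma>.component_in_Hom[OF that] that by (simp add: comp_functor_apply)
  have \<sigma>_nat: "\<sigma> B \<cdot>\<^bsub>D\<^esub> arr_map F (arr_map Q f) = arr_map G (arr_map Q f) \<cdot>\<^bsub>D\<^esub> \<sigma> A"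
    if "f \<in> Hom C A B" for f A B
    using \<sigma>.naturality[OF that] Q.C.HomD(1)[OF that] by (simp add: comp_functor_apply)
  have Fe: "arr_map F (e A) \<in> Hom D (ob_map F (ob_map Q A)) (ob_map F A)"
    "is_iso D (arr_map F (e A))" if "A \<in> Ob L" for A
    using F.arr_map_in_Hom[OF counit_in_Hom_L[OF that]]
      F.arr_map_iso[OF counit_iso_L[OF that] F.C.HomD(1)[OF counit_in_Hom_L[OF that]]] .
  note Ge = G.arr_map_in_Hom[OF counit_in_Hom_L]
  have "\<exists>t. t \<in> Hom D (ob_map F A) (ob_map G A) \<and> t \<cdot>\<^bsub>D\<^esub> arr_map F (e A) = arr_map G (e A) \<cdot>\<^bsub>D\<^esub> \<sigma> A"
    if A: "A \<in> Ob L" for A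
    using F.D.iso_extension[OF Fe(2,1)[OF A] F.D.Comp_in_Hom[OF \<sigma>_Hom Ge[OF A]]] A by auto
  then obtain t where t: "\<And>A. A \<in> Ob L \<Longrightarrow> t A \<in> Hom D (ob_map F A) (ob_map G A)"
    "\<And>A. A \<in> Ob L \<Longrightarrow> t A \<cdot>\<^bsub>D\<^esub> arr_map F (e A) = arr_map G (e A) \<cdot>\<^bsub>D\<^esub> \<sigma> A"
    by metis
  have t_nat: "t B \<cdot>\<^bsub>D\<^esub> arr_map F f = arr_map G f \<cdot>\<^bsub>D\<^esub> t A" if f: "f \<in> Hom L A B" for f A B
  proof (rule F.D.iso_cancel_right)
    note A = F.C.HomD(4)[OF f] and B = F.C.HomD(5)[OF f]
    have f': "f \<in> Hom C A B" using f by (simp add: Hom_full_subcategory)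
    have A': "A \<in> Ob C" and B': "B \<in> Ob C" using Q.C.HomD[OF f'] by auto
    note Qf = Q'.arr_map_in_Hom[OF f']
    note Ff = F.arr_map_in_Hom[OF f] and Gf = G.arr_map_in_Hom[OF f]
    note FQf = F.arr_map_in_Hom[OF Qf] and GQf = G.arr_map_in_Hom[OF Qf]
    note comp = F.D.Comp_assoc and nat = counit_natural[OF f']
    show "arr_map F (e A) \<in> Hom D (ob_map F (ob_map Q A)) (ob_map F A)"
      "is_iso D (arr_map F (e A))"
      using Fe[OF A] .
    show "t B \<cdot>\<^bsub>D\<^esub> arr_map F f \<in> Hom D (ob_map F A) (ob_map G B)"
      using F.D.Comp_in_Hom[OF Ff t(1)[OF B]] .
    show "arr_map G f \<cdot>\<^bsub>D\<^esub> t A \<in> Hom D (ob_map F A) (ob_map G B)"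
      using F.D.Comp_in_Hom[OF t(1)[OF A] Gf] .
    have F_nat: "arr_map F f \<cdot>\<^bsub>D\<^esub> arr_map F (e A) = arr_map F (e B) \<cdot>\<^bsub>D\<^esub> arr_map F (arr_map Q f)"
      using F.arr_map_Comp[OF counit_in_Hom_L[OF A] f] F.arr_map_Comp[OF Qf counit_in_Hom_L[OF B]] nat
      by simp
    have G_nat: "arr_map G f \<cdot>\<^bsub>D\<^esub> arr_map G (e A) = arr_map G (e B) \<cdot>\<^bsub>D\<^esub> arr_map G (arr_map Q f)"
      using G.arr_map_Comp[OF counit_in_Hom_L[OF A] f] G.arr_map_Comp[OF Qf counit_in_Hom_L[OF B]] nat
      by simp
    have "(t B \<cdot>\<^bsub>D\<^esub> arr_map F f) \<cdot>\<^bsub>D\<^esub> arr_map F (e A)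
        = t B \<cdot>\<^bsub>D\<^esub> (arr_map F (e B) \<cdot>\<^bsub>D\<^esub> arr_map F (arr_map Q f))"
      using comp[OF Fe(1)[OF A] Ff t(1)[OF B]] F_nat by simp
    also have "\<dots> = (arr_map G (e B) \<cdot>\<^bsub>D\<^esub> \<sigma> B) \<cdot>\<^bsub>D\<^esub> arr_map F (arr_map Q f)"
      using comp[OF FQf Fe(1)[OF B] t(1)[OF B]] t(2)[OF B] by simp
    also have "\<dots> = arr_map G (e B) \<cdot>\<^bsub>D\<^esub> (arr_map G (arr_map Q f) \<cdot>\<^bsub>D\<^esub> \<sigma> A)"
      using comp[OF FQf \<sigma>_Hom[OF B'] Ge[OF B]] \<sigma>_nat[OF f'] by simp
    also have "\<dots> = (arr_map G f \<cdot>\<^bsub>D\<^esub> arr_map G (e A)) \<cdot>\<^bsub>D\<^esub> \<sigma> A"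
      using comp[OF \<sigma>_Hom[OF A'] GQf Ge[OF B]] G_nat by simp
    also have "\<dots> = arr_map G f \<cdot>\<^bsub>D\<^esub> (t A \<cdot>\<^bsub>D\<^esub> arr_map F (e A))"
      using comp[OF \<sigma>_Hom[OF A'] Ge[OF A] Gf] t(2)[OF A] by simp
    also have "\<dots> = (arr_map G f \<cdot>\<^bsub>D\<^esub> t A) \<cdot>\<^bsub>D\<^esub> arr_map F (e A)"
      using comp[OF Fe(1)[OF A] t(1)[OF A] Gf] by simp
    finally show "(t B \<cdot>\<^bsub>D\<^esub> arr_map F f) \<cdot>\<^bsub>D\<^esub> arr_map F (e A)
        = (arr_map G f \<cdot>\<^bsub>D\<^esub> t A) \<cdot>\<^bsub>D\<^esub> arr_map F (e A)" .
  qed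
  have t_Q: "t (ob_map Q A) = \<sigma> A" if A: "A \<in> Ob C" for A
  proof (rule F.D.iso_cancel_right)
    note QA = Q'.ob_map_in_Ob[OF A]
    show "arr_map F (e (ob_map Q A)) \<in> Hom D (ob_map F (ob_map Q (ob_map Q A))) (ob_map F (ob_map Q A))"
      "is_iso D (arr_map F (e (ob_map Q A)))"
      using Fe[OF QA] .
    show "t (ob_map Q A) \<in> Hom D (ob_map F (ob_map Q A)) (ob_map G (ob_map Q A))"
      using t(1)[OF QA] .
    show "\<sigma> A \<in> Hom D (ob_map F (ob_map Q A)) (ob_map G (ob_map Q A))"
      using \<sigma>_Hom[OF A] .
    \<comment> \<open>Both sides equal \<open>G (e (Q A)) \<cdot> \<sigma> (Q A)\<close>: the left one by the choice of \<open>t\<close>, the right one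
      by naturality of \<open>\<sigma>\<close> at \<open>e A\<close>, once \<open>Q (e A)\<close> is identified with \<open>e (Q A)\<close>.\<close>
    show "t (ob_map Q A) \<cdot>\<^bsub>D\<^esub> arr_map F (e (ob_map Q A)) = \<sigma> A \<cdot>\<^bsub>D\<^esub> arr_map F (e (ob_map Q A))"
      using t(2)[OF QA] \<sigma>_nat[OF counit_in_Hom[OF A]] image_of_counit[OF A] by simp
  qed
  have "nat_trans L D F G (restrict t (Ob L))"
  proof unfold_locales
    show "(restrict t (Ob L)) A \<in> Hom D (ob_map F A) (ob_map G A)" if "A \<in> Ob L" for A
      using t(1)[OF that] that by simp
    show "restrict t (Ob L) B \<cdot>\<^bsub>D\<^esub> arr_map F f = arr_map G f \<cdot>\<^bsub>D\<^esub> restrict t (Ob L) A"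
      if "f \<in> Hom L A B" for f A B
      using t_nat[OF that] F.C.HomD(4,5)[OF that] by simp
  qed simp
  moreover have "restrict t (Ob L) (ob_map Q A) = \<sigma> A" if "A \<in> Ob C" for A
    using t_Q[OF that] Q'.ob_map_in_Ob[OF that] by simp
  ultimately show thesis
    by (rule that)
qed

lemma precomposition_full:
  assumes "category D"
  shows "full_functor (functor_category L D) (functor_category C D) (precomposition C L D Q)"
proof -
  interpret P: cat_functor "functor_category L D" "functor_category C D" "precomposition C L D Q"
    using cat_functor_precomposition[OF cat_functor_corestriction assms] .
  show ?thesis
  proof unfold_locales
    fix F G h
    assume "F \<in> Ob (functor_category L D)" "G \<in> Ob (functor_category L D)"
      and h: "h \<in> Hom (functor_category C D) (ob_map (precomposition C L D Q) F)
        (ob_map (precomposition C L D Q) G)"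
    then have F: "cat_functor L D F" and G: "cat_functor L D G" by auto
    obtain \<sigma> where h_eq: "h = (comp_functor C F Q, comp_functor C G Q, \<sigma>)"
      and \<sigma>: "nat_trans C D (comp_functor C F Q) (comp_functor C G Q) \<sigma>"
      using h F G by (auto simp: Hom_functor_category precomposition_apply)
    obtain \<tau> where \<tau>: "nat_trans L D F G \<tau>" "\<And>A. A \<in> Ob C \<Longrightarrow> \<tau> (ob_map Q A) = \<sigma> A"
      using whiskering_surjective[OF F G \<sigma>] by blast
    have "(\<lambda>A\<in>Ob C. \<tau> (ob_map Q A)) = \<sigma>"
      using nat_trans_eqI[OF nat_trans_whisker[OF cat_functor_corestriction \<tau>(1)] \<sigma>] \<tau>(2) by simp
    then have "arr_map (precomposition C L D Q) (F, G, \<tau>) = h"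
      using precomposition_apply(2)[OF \<tau>(1), of C Q] h_eq by simp
    moreover have "(F, G, \<tau>) \<in> Hom (functor_category L D) F G"
      using \<tau>(1) by (simp add: Hom_functor_category)
    ultimately show "\<exists>f\<in>Hom (functor_category L D) F G. arr_map (precomposition C L D Q) f = h"
      by blast
  qed
qed

theorem localisation_at_counit:
  "localisation TYPE(('d, 'e) category) C {e A | A. A \<in> Ob C} L Q"
  unfolding localisation_def
proof (intro conjI ballI allI impI)
  show "category C" by unfold_locales
  show "{e A | A. A \<in> Ob C} \<subseteq> Arr C"
    using Q.C.HomD(1)[OF counit_in_Hom] by blast
  show "category L" by (rule Q.C.category_full_subcategory)
  show "cat_functor C L Q" by (rule cat_functor_corestriction)
  show "is_iso L (arr_map Q f)" if "f \<in> {e A | A. A \<in> Ob C}" for f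
    using that image_of_counit counit_iso_L cat_functor.ob_map_in_Ob[OF cat_functor_corestriction]
    by auto
  show "\<exists>R' \<tau>. cat_functor L D R' \<and> nat_iso C D (comp_functor C R' Q) R \<tau>"
    if "cat_functor C D R \<and> (\<forall>f\<in>{e A | A. A \<in> Ob C}. is_iso D (arr_map R f))"
    for D :: "('d, 'e) category" and R
    by (rule extension_of_inverting_functor) (use that in auto)
qed (simp_all add: precomposition_full precomposition_faithful)

end


section \<open>Localisation at a subunit\<close>

text \<open>
  A localisation at \<open>W\<close> depends on \<open>W\<close> only through the functors that invert \<open>W\<close>, and a functor
  inverts \<open>g \<cdot> f\<close> with \<open>g\<close> an isomorphism exactly when it inverts \<open>f\<close>.
\<close>

lemma localisation_cancel_iso:
  assumes loc: "localisation TYPE(('d, 'e) category) C {g i \<cdot>\<^bsub>C\<^esub> f i | i. i \<in> J} L Q"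
    and f: "\<And>i. i \<in> J \<Longrightarrow> f i \<in> Hom C (X i) (Y i)"
    and g: "\<And>i. i \<in> J \<Longrightarrow> g i \<in> Hom C (Y i) (Z i)" "\<And>i. i \<in> J \<Longrightarrow> is_iso C (g i)"
  shows "localisation TYPE(('d, 'e) category) C {f i | i. i \<in> J} L Q"
proof -
  have C: "category C" and Q: "cat_functor C L Q"
    using loc by (auto simp: localisation_def)
  have inverts_iff: "(\<forall>w\<in>{g i \<cdot>\<^bsub>C\<^esub> f i | i. i \<in> J}. is_iso D (arr_map R w))
      \<longleftrightarrow> (\<forall>w\<in>{f i | i. i \<in> J}. is_iso D (arr_map R w))"
    if R: "cat_functor C D R" for D :: "('p, 'n, 'r) category_scheme" and R
  proof -
    have "is_iso D (arr_map R (g i \<cdot>\<^bsub>C\<^esub> f i)) \<longleftrightarrow> is_iso D (arr_map R (f i))" if "i \<in> J" for i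
      using cat_functor.arr_map_cancel_iso[OF R g(2) f g(1)] that by simp
    then show ?thesis by auto
  qed
  show ?thesis
    unfolding localisation_def
  proof (intro conjI allI impI)
    show "category C" "category L" "cat_functor C L Q"
      using loc by (simp_all add: localisation_def)
    show "{f i | i. i \<in> J} \<subseteq> Arr C"
      using category.HomD(1)[OF C f] by blast
    show "\<forall>w\<in>{f i | i. i \<in> J}. is_iso L (arr_map Q w)"
      unfolding inverts_iff[OF Q, symmetric] using loc unfolding localisation_def by (elim conjE)
    show "\<exists>R' \<tau>. cat_functor L D R' \<and> nat_iso C D (comp_functor C R' Q) R \<tau>"
      if "cat_functor C D R \<and> (\<forall>w\<in>{f i | i. i \<in> J}. is_iso D (arr_map R w))"
      for D :: "('d, 'e) category" and R
    proof -
      have "\<forall>w\<in>{g i \<cdot>\<^bsub>C\<^esub> f i | i. i \<in> J}. is_iso D (arr_map R w)"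
        unfolding inverts_iff[OF conjunct1[OF that]] using that by (rule conjunct2)
      moreover have "cat_functor C D R \<and> (\<forall>w\<in>{g i \<cdot>\<^bsub>C\<^esub> f i | i. i \<in> J}. is_iso D (arr_map R w))
          \<longrightarrow> (\<exists>R' \<tau>. cat_functor L D R' \<and> nat_iso C D (comp_functor C R' Q) R \<tau>)"
        using loc unfolding localisation_def by (elim conjE) (rule spec2)
      ultimately show ?thesis
        using conjunct1[OF that] by (iprover intro: conjI elim: mp)
    qed
    show "full_functor (functor_category L D) (functor_category C D) (precomposition C L D Q)"
      "faithful_functor (functor_category L D) (functor_category C D) (precomposition C L D Q)"
      if "category D" for D :: "('d, 'e) category"
      using loc that by (simp_all add: localisation_def)
  qed
qed

context monoidal_category
begin

lemma is_iso_tensor: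
  assumes "is_iso C f" "is_iso C g" and f: "f \<in> Hom C X Y" and g: "g \<in> Hom C X' Y'"
  shows "is_iso C (f \<otimes>\<^sub>a g)"
proof -
  obtain f' where f': "f' \<in> Hom C Y X" "f' \<cdot> f = Id C X" "f \<cdot> f' = Id C Y"
    using isoE[OF assms(1) f] by blast
  obtain g' where g': "g' \<in> Hom C Y' X'" "g' \<cdot> g = Id C X'" "g \<cdot> g' = Id C Y'"
    using isoE[OF assms(2) g] by blast
  show ?thesis
    using isoI[OF tensor_arr_in_Hom[OF f g] tensor_arr_in_Hom[OF f'(1) g'(1)]]
      tensor_Comp[OF f f'(1) g g'(1)] tensor_Comp[OF f'(1) f g'(1) g] tensor_Id
      f' g' HomD[OF f] HomD[OF g] by simp
qed

lemma cat_functor_restriction_functor: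
  assumes S: "S \<in> Ob C"
  shows "cat_functor C C (restriction_functor C S)"
proof
  fix f g X Y Z assume f: "f \<in> Hom C X Y" and g: "g \<in> Hom C Y Z"
  show "arr_map (restriction_functor C S) (g \<cdot> f)
      = arr_map (restriction_functor C S) g \<cdot> arr_map (restriction_functor C S) f"
    using tensor_Comp[OF Id_in_Hom[OF S] Id_in_Hom[OF S] f g] Comp_Id[OF Id_in_Hom[OF S]]
      HomD[OF f] HomD[OF g] HomD[OF Comp_in_Hom[OF f g]]
    by (simp add: restriction_functor_def)
next
  fix f A B assume f: "f \<in> Hom C A B"
  show "arr_map (restriction_functor C S) f
      \<in> Hom C (ob_map (restriction_functor C S) A) (ob_map (restriction_functor C S) B)"
    using tensor_arr_in_Hom[OF Id_in_Hom[OF S] f] HomD[OF f] by (simp add: restriction_functor_def)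
next
  fix A assume A: "A \<in> Ob C"
  show "arr_map (restriction_functor C S) (Id C A) = Id C (ob_map (restriction_functor C S) A)"
    using A HomD(1)[OF Id_in_Hom[OF A]] by (simp add: restriction_functor_def tensor_Id S)
qed (simp_all add: restriction_functor_def S tensor_ob_in_Ob)

end

theorem proposition5p2:
  fixes C :: "('o, 'm, 'z) braided_monoidal_category_scheme"
    and S :: "'o" and s :: "'m"
  assumes "braided_monoidal_category C"
    and "subunit C S s"
  shows "localisation TYPE(('d, 'e) category) C {s \<otimes>\<^sub>a\<^bsub>C\<^esub> Id C A | A. A \<in> Ob C}
           (restriction_category C s) (restriction_functor C S)"
proof -
  interpret braided_monoidal_category C by fact
  have s: "s \<in> Hom C S (unit_ob C)" and sS_iso: "is_iso C (s \<otimes>\<^sub>a\<^bsub>C\<^esub> Id C S)"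
    using assms(2) by (auto simp: subunit_def)
  note S = HomD(4)[OF s]
  note IdS = Id_in_Hom[OF S]
  note sS = tensor_arr_in_Hom[OF s IdS] and Ss = tensor_arr_in_Hom[OF IdS s]
  define e where "e A = left_unitor C A \<cdot>\<^bsub>C\<^esub> (s \<otimes>\<^sub>a\<^bsub>C\<^esub> Id C A)" for A
  have sA: "s \<otimes>\<^sub>a\<^bsub>C\<^esub> Id C A \<in> Hom C (S \<otimes>\<^sub>o\<^bsub>C\<^esub> A) (unit_ob C \<otimes>\<^sub>o\<^bsub>C\<^esub> A)" if "A \<in> Ob C" for A
    using tensor_arr_in_Hom[OF s Id_in_Hom[OF that]] .
  have e_iso_iff: "is_iso C (e A) \<longleftrightarrow> is_iso C (s \<otimes>\<^sub>a\<^bsub>C\<^esub> Id C A)" if "A \<in> Ob C" for A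
    using is_iso_Comp[OF _ left_unitor_iso[OF that] sA[OF that] left_unitor_in_Hom[OF that]]
      is_iso_Comp_cancel_left[OF left_unitor_iso[OF that] _ sA[OF that] left_unitor_in_Hom[OF that]]
    unfolding e_def by blast
  have e_Hom: "e A \<in> Hom C (S \<otimes>\<^sub>o\<^bsub>C\<^esub> A) A" if "A \<in> Ob C" for A
    unfolding e_def using Comp_in_Hom[OF sA[OF that] left_unitor_in_Hom[OF that]] .
  \<comment> \<open>Naturality of the braiding at \<open>s\<close> makes \<open>S \<otimes> s\<close> a conjugate of \<open>s \<otimes> S\<close>.\<close>
  have Ss_iso: "is_iso C (Id C S \<otimes>\<^sub>a\<^bsub>C\<^esub> s)"
    using is_iso_commutative_square[OF braiding_iso[OF S S] braiding_iso[OF unit_in_Ob S] sS_iso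
        braiding_in_Hom[OF S S] braiding_in_Hom[OF unit_in_Ob S] sS Ss braiding_natural[OF s IdS]] .
  interpret idempotent_copointed_endofunctor C "restriction_functor C S" e
  proof (rule idempotent_copointed_endofunctor.intro[OF cat_functor_restriction_functor[OF S]], unfold_locales)
    fix A assume A: "A \<in> Ob C"
    note IdA = Id_in_Hom[OF A]
    show "e A \<in> Hom C (ob_map (restriction_functor C S) A) A"
      using e_Hom[OF A] A by (simp add: restriction_functor_def)
    \<comment> \<open>The associator carries \<open>(s \<otimes> S) \<otimes> A\<close> to \<open>s \<otimes> (S \<otimes> A)\<close>, and \<open>(S \<otimes> s) \<otimes> A\<close> to
      \<open>S \<otimes> (s \<otimes> A)\<close> below.\<close>
    have "is_iso C (s \<otimes>\<^sub>a\<^bsub>C\<^esub> (Id C S \<otimes>\<^sub>a\<^bsub>C\<^esub> Id C A))"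
      using is_iso_commutative_square[OF associator_iso[OF S S A] associator_iso[OF unit_in_Ob S A]
          is_iso_tensor[OF sS_iso is_iso_Id[OF A] sS IdA]
          associator_in_Hom[OF S S A] associator_in_Hom[OF unit_in_Ob S A]
          tensor_arr_in_Hom[OF sS IdA] tensor_arr_in_Hom[OF s tensor_arr_in_Hom[OF IdS IdA]]
          associator_natural[OF s IdS IdA]] .
    then show "is_iso C (e (ob_map (restriction_functor C S) A))"
      using A S by (simp add: restriction_functor_def e_iso_iff tensor_ob_in_Ob tensor_Id)
    have "is_iso C (Id C S \<otimes>\<^sub>a\<^bsub>C\<^esub> (s \<otimes>\<^sub>a\<^bsub>C\<^esub> Id C A))"
      using is_iso_commutative_square[OF associator_iso[OF S S A] associator_iso[OF S unit_in_Ob A]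
          is_iso_tensor[OF Ss_iso is_iso_Id[OF A] Ss IdA]
          associator_in_Hom[OF S S A] associator_in_Hom[OF S unit_in_Ob A]
          tensor_arr_in_Hom[OF Ss IdA] tensor_arr_in_Hom[OF IdS sA[OF A]]
          associator_natural[OF IdS s IdA]] .
    then have "is_iso C ((Id C S \<otimes>\<^sub>a\<^bsub>C\<^esub> left_unitor C A) \<cdot>\<^bsub>C\<^esub> (Id C S \<otimes>\<^sub>a\<^bsub>C\<^esub> (s \<otimes>\<^sub>a\<^bsub>C\<^esub> Id C A)))"
      using is_iso_Comp[OF _ is_iso_tensor[OF is_iso_Id[OF S] left_unitor_iso[OF A] IdS
            left_unitor_in_Hom[OF A]] tensor_arr_in_Hom[OF IdS sA[OF A]]
          tensor_arr_in_Hom[OF IdS left_unitor_in_Hom[OF A]]] by blast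
    then have "is_iso C (Id C S \<otimes>\<^sub>a\<^bsub>C\<^esub> e A)"
      using tensor_Comp[OF IdS IdS sA[OF A] left_unitor_in_Hom[OF A]] Comp_Id[OF IdS]
      by (simp add: e_def)
    then show "is_iso C (arr_map (restriction_functor C S) (e A))"
      using HomD(1)[OF e_Hom[OF A]] by (simp add: restriction_functor_def)
  next
    fix f A B assume f: "f \<in> Hom C A B"
    note A = HomD(4)[OF f] and B = HomD(5)[OF f]
    note I = Id_in_Hom[OF unit_in_Ob]
    \<comment> \<open>Interchange: both sides are \<open>s \<otimes> f\<close>.\<close>
    have "(s \<otimes>\<^sub>a\<^bsub>C\<^esub> Id C B) \<cdot>\<^bsub>C\<^esub> (Id C S \<otimes>\<^sub>a\<^bsub>C\<^esub> f) = (Id C (unit_ob C) \<otimes>\<^sub>a\<^bsub>C\<^esub> f) \<cdot>\<^bsub>C\<^esub> (s \<otimes>\<^sub>a\<^bsub>C\<^esub> Id C A)"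
      using tensor_Comp[OF IdS s f Id_in_Hom[OF B]] tensor_Comp[OF s I Id_in_Hom[OF A] f]
      by (simp add: Comp_Id[OF s] Id_Comp[OF s] Comp_Id[OF f] Id_Comp[OF f])
    then have "e B \<cdot>\<^bsub>C\<^esub> (Id C S \<otimes>\<^sub>a\<^bsub>C\<^esub> f)
        = (left_unitor C B \<cdot>\<^bsub>C\<^esub> (Id C (unit_ob C) \<otimes>\<^sub>a\<^bsub>C\<^esub> f)) \<cdot>\<^bsub>C\<^esub> (s \<otimes>\<^sub>a\<^bsub>C\<^esub> Id C A)"
      unfolding e_def
      using Comp_assoc[OF tensor_arr_in_Hom[OF IdS f] sA[OF B] left_unitor_in_Hom[OF B]]
        Comp_assoc[OF sA[OF A] tensor_arr_in_Hom[OF I f] left_unitor_in_Hom[OF B]] by simp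
    also have "\<dots> = f \<cdot>\<^bsub>C\<^esub> e A"
      unfolding e_def left_unitor_natural[OF f]
      using Comp_assoc[OF sA[OF A] left_unitor_in_Hom[OF A] f] .
    finally show "e B \<cdot>\<^bsub>C\<^esub> arr_map (restriction_functor C S) f = f \<cdot>\<^bsub>C\<^esub> e A"
      using HomD(1)[OF f] by (simp add: restriction_functor_def)
  qed
  have "restriction_category C s = L"
    unfolding restriction_category_def
    by (rule full_subcategory_cong[OF category_axioms]) (simp add: e_iso_iff)
  then show ?thesis
    using localisation_cancel_iso[OF localisation_at_counit[unfolded e_def] sA left_unitor_in_Hom
        left_unitor_iso] by (simp add: e_def)
qed

end
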